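(* There exists a non-autonomous IFS $(\Phi^{(j)})_{j=1}^\infty$ on some compact metric space whose limit set is homeomorphic to the topologist's sine curve.
   Context: Let $X$ be a non-empty compact metric space; $\mathrm{Lip}(f)$ denotes the Lipschitz constant of $f\colon X\to X$. A non-autonomous IFS $(\Phi^{(j)})_{j\ge1}$ on $X$ is a sequence of collections $\Phi^{(j)}=\{f^{(j)}_i\colon X\to X\}_{i\in I^{(j)}}$ of maps, with each index set $I^{(j)}$ finite and non-empty, such that there is a constant $c<1$ with $\mathrm{Lip}(f^{(j)}_i)\le c$ for all $j\ge1$, $i\in I^{(j)}$. Its coding map $\Pi\colon\prod_{j\ge1}I^{(j)}\to X$ is defined by $\{\Pi(i_1,i_2,\dots)\}=\bigcap_{j\ge1}f^{(1)}_{i_1}\circ\cdots\circ f^{(j)}_{i_j}(X)$, and its limit set is $J=\Pi(\prod_{j\ge1}I^{(j)})$. The topologist's sine curve is the compact set $(\{0\}\times[-1,1])\cup\{(x,\sin(1/x)) : 0<x\le1\}\subset\mathbb R^2$. *)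

theory Defs
  imports "HOL-Analysis.Analysis"
begin

text \<open>
  The least Lipschitz constant of \<open>g\<close> on the metric space \<open>(X, d)\<close>; it is \<open>\<infinity>\<close> when
  \<open>g\<close> is not Lipschitz.
\<close>

definition Lip :: "'a set \<Rightarrow> ('a \<Rightarrow> 'a \<Rightarrow> real) \<Rightarrow> ('a \<Rightarrow> 'a) \<Rightarrow> ennreal" where
  "Lip X d g = Inf {ennreal L | L. 0 \<le> L \<and> (\<forall>x\<in>X. \<forall>y\<in>X. d (g x) (g y) \<le> L * d x y)}"

text \<open>
  Levels are numbered from 1: the values of \<open>I\<close> and \<open>f\<close> at level 0 are unconstrained and
  are never used. Likewise only the values of \<open>f j i\<close> on the carrier \<open>X\<close> matter.
\<close>

locale nonautonomous_IFS = Metric_space X d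
  for X :: "'a set" and d :: "'a \<Rightarrow> 'a \<Rightarrow> real" +
  fixes I :: "nat \<Rightarrow> 'i set"
    and f :: "nat \<Rightarrow> 'i \<Rightarrow> 'a \<Rightarrow> 'a"
  assumes nonempty_space: "X \<noteq> {}"
    and compact_metric: "compact_space mtopology"
    and finite_index: "\<And>j. 1 \<le> j \<Longrightarrow> finite (I j)"
    and nonempty_index: "\<And>j. 1 \<le> j \<Longrightarrow> I j \<noteq> {}"
    and self_map: "\<And>j i. 1 \<le> j \<Longrightarrow> i \<in> I j \<Longrightarrow> f j i \<in> X \<rightarrow> X"
    and uniformly_contracting: "\<exists>c<1. \<forall>j\<ge>1. \<forall>i\<in>I j. Lip X d (f j i) \<le> c"

text \<open>\<open>comp_upto f \<omega> n\<close> is \<open>f 1 (\<omega> 1) \<circ> \<dots> \<circ> f n (\<omega> n)\<close>.\<close>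

primrec comp_upto :: "(nat \<Rightarrow> 'i \<Rightarrow> 'a \<Rightarrow> 'a) \<Rightarrow> (nat \<Rightarrow> 'i) \<Rightarrow> nat \<Rightarrow> 'a \<Rightarrow> 'a" where
  "comp_upto f \<omega> 0 = id"
| "comp_upto f \<omega> (Suc n) = comp_upto f \<omega> n \<circ> f (Suc n) (\<omega> (Suc n))"

definition coding_map :: "'a set \<Rightarrow> (nat \<Rightarrow> 'i \<Rightarrow> 'a \<Rightarrow> 'a) \<Rightarrow> (nat \<Rightarrow> 'i) \<Rightarrow> 'a" where
  "coding_map X f \<omega> = (THE x. {x} = (\<Inter>j\<in>{1..}. comp_upto f \<omega> j ` X))"

definition limit_set :: "'a set \<Rightarrow> (nat \<Rightarrow> 'i set) \<Rightarrow> (nat \<Rightarrow> 'i \<Rightarrow> 'a \<Rightarrow> 'a) \<Rightarrow> 'a set" where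
  "limit_set X I f = coding_map X f ` (\<Pi>\<^sub>E j\<in>{1..}. I j)"

definition topologists_sine_curve :: "(real \<times> real) set" where
  "topologists_sine_curve = {0} \<times> {-1..1} \<union> {(x, sin (1 / x)) | x. 0 < x \<and> x \<le> 1}"

text \<open>
  HOL cannot quantify over the carrier type of a metric space inside a formula. An existential
  statement over all compact metric spaces loses nothing by taking carriers in
  \<open>real \<times> real\<close> with an arbitrary metric \<open>d\<close> (unrelated to the Euclidean one): a compact metric
  space has at most the cardinality of the continuum, so it is isometric to one of these.
  Similarly, finite index sets may be taken to be sets of natural numbers.
\<close>

end

theory Submission
  imports Defs
begin

text \<open>
  The sine curve is, up to homeomorphism, a Lipschitz image of a self-similar set.  Replacing the
  coordinate \<open>x\<close> by \<open>exp (- 1 / x)\<close>, read as \<open>0\<close> at \<open>x = 0\<close>, turns the curve into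
  \<open>W = {0} \<times> [-1, 1] \<union> {(exp (- s), sin s) | s \<ge> 1}\<close>, which is homeomorphic to the original.
  By periodicity of the sine, writing \<open>s = \<theta> + 2 \<pi> k\<close> with \<open>\<theta> \<in> [1, 1 + 2 \<pi>]\<close> exhibits \<open>W\<close> as the
  image of \<open>C \<times> [1, 1 + 2 \<pi>]\<close> under the Lipschitz map \<open>(x, \<theta>) \<mapsto> (x exp (- \<theta>), sin \<theta>)\<close>, where
  \<open>C = {0} \<union> {exp (- 2 \<pi>)^k | k \<ge> 0}\<close>; the point \<open>0 \<in> C\<close> accounts for the limiting segment.

  The set \<open>E = C \<times> [-1, 1]\<close> is the attractor of four contractions of the rectangle
  \<open>[0, 1] \<times> [-1, 1]\<close> (lemma \<open>comb_eq\<close>): these are used at all levels from 2 on.  At level 1, the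
  interval \<open>[1, 1 + 2 \<pi>]\<close> is cut into 32 pieces of equal length, so short that the Lipschitz map
  above, precomposed with the affine maps from \<open>[-1, 1]\<close> onto the pieces, becomes a contraction of
  the rectangle; the union of the 32 images of \<open>E\<close> is \<open>W\<close> (lemma \<open>damped_wave_eq\<close>).  The sets
  \<open>W, E, E, \<dots>\<close> thus satisfy the recursion that characterises the limit sets of the tails of the
  system, hence \<open>W\<close> is the limit set (lemma \<open>limit_set_eqI\<close>).
\<close>

section \<open>Limit sets of systems on a compact set\<close>

lemma comp_upto_lipschitz:
  fixes X :: "'a::metric_space set"
  assumes "0 \<le> c"
    and f_self: "\<And>j x. 1 \<le> j \<Longrightarrow> x \<in> X \<Longrightarrow> f j (\<omega> j) x \<in> X"
    and f_lip: "\<And>j x y. 1 \<le> j \<Longrightarrow> x \<in> X \<Longrightarrow> y \<in> X \<Longrightarrow>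
        dist (f j (\<omega> j) x) (f j (\<omega> j) y) \<le> c * dist x y"
    and "x \<in> X" "y \<in> X"
  shows "dist (comp_upto f \<omega> n x) (comp_upto f \<omega> n y) \<le> c ^ n * dist x y"
  using \<open>x \<in> X\<close> \<open>y \<in> X\<close>
proof (induction n arbitrary: x y)
  case 0
  then show ?case by simp
next
  case (Suc n)
  have "dist (comp_upto f \<omega> (Suc n) x) (comp_upto f \<omega> (Suc n) y)
      \<le> c ^ n * dist (f (Suc n) (\<omega> (Suc n)) x) (f (Suc n) (\<omega> (Suc n)) y)"
    using Suc f_self by simp
  also have "\<dots> \<le> c ^ n * (c * dist x y)"
    using Suc.prems f_lip \<open>0 \<le> c\<close> by (intro mult_left_mono) auto
  finally show ?case by (simp add: mult_ac)
qed

lemma coding_map_eqI: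
  fixes X :: "'a::metric_space set"
  assumes "compact X" "0 \<le> c" "c < 1"
    and f_self: "\<And>j x. 1 \<le> j \<Longrightarrow> x \<in> X \<Longrightarrow> f j (\<omega> j) x \<in> X"
    and f_lip: "\<And>j x y. 1 \<le> j \<Longrightarrow> x \<in> X \<Longrightarrow> y \<in> X \<Longrightarrow>
        dist (f j (\<omega> j) x) (f j (\<omega> j) y) \<le> c * dist x y"
    and p: "\<And>n. p \<in> comp_upto f \<omega> n ` X"
  shows "coding_map X f \<omega> = p"
proof -
  have "q = p" if q: "\<forall>n\<ge>1. q \<in> comp_upto f \<omega> n ` X" for q
  proof -
    \<comment> \<open>At every level, both points lie in the same cylinder set.\<close>
    have bound: "dist q p \<le> c ^ n * diameter X" if n: "n \<ge> 1" for n
    proof -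
      obtain x y where xy: "x \<in> X" "y \<in> X" "q = comp_upto f \<omega> n x" "p = comp_upto f \<omega> n y"
        using q n p[of n] by (metis imageE)
      have "dist q p \<le> c ^ n * dist x y"
        unfolding xy(3,4) using comp_upto_lipschitz[of c X f \<omega>] f_self f_lip xy(1,2) \<open>0 \<le> c\<close> by blast
      also have "\<dots> \<le> c ^ n * diameter X"
        using xy \<open>0 \<le> c\<close> \<open>compact X\<close>
        by (intro mult_left_mono diameter_bounded_bound compact_imp_bounded) auto
      finally show ?thesis .
    qed
    have "(\<lambda>n. c ^ n * diameter X) \<longlonglongrightarrow> 0 * diameter X"
      using \<open>0 \<le> c\<close> \<open>c < 1\<close> by (intro tendsto_intros LIMSEQ_realpow_zero) auto
    then have "dist q p \<le> 0 * diameter X"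
      by (rule LIMSEQ_le_const) (use bound in blast)
    then show ?thesis by simp
  qed
  then have "{p} = (\<Inter>j\<in>{1..}. comp_upto f \<omega> j ` X)"
    using p by auto
  then show ?thesis
    unfolding coding_map_def by (intro the_equality) auto
qed

text \<open>
  The limit sets \<open>E n\<close> of the tails of the system satisfy \<open>E n = (\<Union>i. f n i ` E (n + 1))\<close>.
  Conversely, this recursion determines them among sequences of nonempty compact subsets of \<open>X\<close>.
\<close>

lemma limit_set_eqI:
  fixes X :: "'a::heine_borel set"
  assumes "compact X" "0 \<le> c" "c < 1"
    and f_self: "\<And>j i x. 1 \<le> j \<Longrightarrow> i \<in> I j \<Longrightarrow> x \<in> X \<Longrightarrow> f j i x \<in> X"
    and f_lip: "\<And>j i x y. 1 \<le> j \<Longrightarrow> i \<in> I j \<Longrightarrow> x \<in> X \<Longrightarrow> y \<in> X \<Longrightarrow>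
        dist (f j i x) (f j i y) \<le> c * dist x y"
    and E: "\<And>j. 1 \<le> j \<Longrightarrow> compact (E j)" "\<And>j. 1 \<le> j \<Longrightarrow> E j \<noteq> {}" "\<And>j. 1 \<le> j \<Longrightarrow> E j \<subseteq> X"
    and E_eq: "\<And>j. 1 \<le> j \<Longrightarrow> E j = (\<Union>i\<in>I j. f j i ` E (Suc j))"
  shows "limit_set X I f = E 1"
proof
  show "limit_set X I f \<subseteq> E 1"
    unfolding limit_set_def
  proof (rule image_subsetI)
    fix \<omega> assume "\<omega> \<in> (\<Pi>\<^sub>E j\<in>{1..}. I j)"
    then have \<omega>: "\<omega> j \<in> I j" if "1 \<le> j" for j
      using that by (auto simp: PiE_iff)
    have lip: "dist (comp_upto f \<omega> n x) (comp_upto f \<omega> n y) \<le> c ^ n * dist x y"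
      if "x \<in> X" "y \<in> X" for n x y
      by (rule comp_upto_lipschitz[where X = X]) (use \<omega> f_self f_lip that \<open>0 \<le> c\<close> in auto)
    define F where "F n = comp_upto f \<omega> n ` E (Suc n)" for n
    have step: "F (Suc n) \<subseteq> F n" for n
    proof -
      have "f (Suc n) (\<omega> (Suc n)) ` E (Suc (Suc n)) \<subseteq> E (Suc n)"
        using E_eq[of "Suc n"] \<omega>[of "Suc n"] by auto
      then show ?thesis
        by (auto simp: F_def)
    qed
    have "\<Inter>(range F) \<noteq> {}"
    proof (rule compact_nest)
      fix n
      have "continuous_on X (comp_upto f \<omega> n)"
        by (rule lipschitz_on_continuous_on[of "c ^ n"])
          (use lip \<open>0 \<le> c\<close> in \<open>auto simp: lipschitz_on_def\<close>)
      then show "compact (F n)"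
        unfolding F_def using E[of "Suc n"]
        by (intro compact_continuous_image) (auto intro: continuous_on_subset)
      show "F n \<noteq> {}"
        unfolding F_def using E[of "Suc n"] by auto
    next
      fix m n :: nat assume "m \<le> n"
      then show "F n \<subseteq> F m"
        by (rule lift_Suc_antimono_le[of F, OF step])
    qed
    then obtain p where p: "\<And>n. p \<in> F n" by blast
    have "coding_map X f \<omega> = p"
    proof (rule coding_map_eqI[OF \<open>compact X\<close> \<open>0 \<le> c\<close> \<open>c < 1\<close>])
      show "p \<in> comp_upto f \<omega> n ` X" for n
        using p[of n] E(3)[of "Suc n"] by (auto simp: F_def)
    qed (use \<omega> f_self f_lip in auto)
    moreover have "p \<in> E 1"
      using p[of 0] by (simp add: F_def)
    ultimately show "coding_map X f \<omega> \<in> E 1" by simp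
  qed
next
  show "E 1 \<subseteq> limit_set X I f"
  proof
    fix p assume "p \<in> E 1"
    \<comment> \<open>Choose, level by level, an index whose map has the current point in its image, together
        with a preimage, which is the next point.\<close>
    have "\<exists>s. \<forall>n. (snd (s n) \<in> E (Suc n) \<and> (n = 0 \<longrightarrow> snd (s n) = p)) \<and>
        (fst (s (Suc n)) \<in> I (Suc n) \<and>
         snd (s n) = f (Suc n) (fst (s (Suc n))) (snd (s (Suc n))))"
    proof (rule dependent_nat_choice)
      show "\<exists>x. snd x \<in> E (Suc 0) \<and> (0 = (0::nat) \<longrightarrow> snd x = p)"
        using \<open>p \<in> E 1\<close> by auto
    next
      fix x :: "'b \<times> 'a" and n
      assume "snd x \<in> E (Suc n) \<and> (n = 0 \<longrightarrow> snd x = p)"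
      then have "snd x \<in> (\<Union>i\<in>I (Suc n). f (Suc n) i ` E (Suc (Suc n)))"
        using E_eq[of "Suc n"] by simp
      then show "\<exists>y. (snd y \<in> E (Suc (Suc n)) \<and> (Suc n = 0 \<longrightarrow> snd y = p)) \<and>
          fst y \<in> I (Suc n) \<and> snd x = f (Suc n) (fst y) (snd y)"
        by auto
    qed
    then obtain s where s: "\<And>n. snd (s n) \<in> E (Suc n)" "snd (s 0) = p"
      "\<And>n. fst (s (Suc n)) \<in> I (Suc n)"
      "\<And>n. snd (s n) = f (Suc n) (fst (s (Suc n))) (snd (s (Suc n)))"
      by blast
    define \<omega> where "\<omega> = restrict (\<lambda>n. fst (s n)) {1..}"
    have \<omega>_mem: "\<omega> \<in> (\<Pi>\<^sub>E j\<in>{1..}. I j)"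
      unfolding \<omega>_def using s(3) by (auto simp: Suc_le_eq gr0_conv_Suc)
    have \<omega>: "\<omega> j \<in> I j" if "1 \<le> j" for j
      using \<omega>_mem that by (auto simp: PiE_iff)
    have p: "comp_upto f \<omega> n (snd (s n)) = p" for n
      by (induction n) (simp_all add: \<omega>_def s(2) flip: s(4))
    have "coding_map X f \<omega> = p"
    proof (rule coding_map_eqI[OF \<open>compact X\<close> \<open>0 \<le> c\<close> \<open>c < 1\<close>])
      show "p \<in> comp_upto f \<omega> n ` X" for n
        using p[of n] s(1)[of n] E(3)[of "Suc n"] by force
    qed (use \<omega> f_self f_lip in auto)
    with \<omega>_mem show "p \<in> limit_set X I f"
      unfolding limit_set_def by blast
  qed
qed

lemma Lip_le:
  assumes "0 \<le> L" "\<And>x y. x \<in> X \<Longrightarrow> y \<in> X \<Longrightarrow> d (g x) (g y) \<le> L * d x y"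
  shows "Lip X d g \<le> ennreal L"
  unfolding Lip_def using assms by (intro Inf_lower) blast

lemma mtopology_dist_eq: "Metric_space.mtopology X dist = top_of_set X"
  for X :: "'a::metric_space set"
proof -
  interpret Submetric UNIV dist X
    by unfold_locales auto
  show ?thesis
    using mtopology_submetric by simp
qed

lemma nonautonomous_IFS_dist:
  fixes X :: "'a::metric_space set"
  assumes "compact X" "X \<noteq> {}" "0 \<le> c" "c < 1"
    and "\<And>j. 1 \<le> j \<Longrightarrow> finite (I j)" "\<And>j. 1 \<le> j \<Longrightarrow> I j \<noteq> {}"
    and "\<And>j i x. 1 \<le> j \<Longrightarrow> i \<in> I j \<Longrightarrow> x \<in> X \<Longrightarrow> f j i x \<in> X"
    and f_lip: "\<And>j i x y. 1 \<le> j \<Longrightarrow> i \<in> I j \<Longrightarrow> x \<in> X \<Longrightarrow> y \<in> X \<Longrightarrow>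
        dist (f j i x) (f j i y) \<le> c * dist x y"
  shows "nonautonomous_IFS X dist I f"
proof -
  interpret Metric_space X dist
    by (rule Met_TC.subspace) simp
  show ?thesis
  proof
    show "compact_space mtopology"
      using \<open>compact X\<close> by (simp add: mtopology_dist_eq compact_space_subtopology)
    show "\<exists>c<1. \<forall>j\<ge>1. \<forall>i\<in>I j. Lip X dist (f j i) \<le> c"
    proof (intro exI conjI allI impI ballI)
      show "ennreal c < 1"
        using \<open>c < 1\<close> \<open>0 \<le> c\<close> by (simp add: ennreal_less_one_iff)
      show "Lip X dist (f j i) \<le> ennreal c" if "1 \<le> j" "i \<in> I j" for j i
        using that f_lip \<open>0 \<le> c\<close> by (intro Lip_le) auto
    qed
  qed (use assms in auto)
qed

section \<open>The comb over a geometric sequence\<close>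

text \<open>The factor by which \<open>exp (- s)\<close> shrinks over one period of the sine.\<close>

definition ratio :: real where
  "ratio = exp (- 2 * pi)"

text \<open>Vertical teeth over the points \<open>ratio ^ k\<close> and over their limit \<open>0\<close>.\<close>

definition comb :: "(real \<times> real) set" where
  "comb = insert 0 (range (\<lambda>k. ratio ^ k)) \<times> {-1..1}"

text \<open>
  The maps for \<open>i < 4\<close> take the comb onto the upper or lower half of the tooth at \<open>1\<close>, or onto the
  upper or lower half of the union of all other teeth: \<open>2 \<le> i\<close> selects the scaling of the first
  coordinate, and the parity of \<open>i\<close> the half.
\<close>

definition comb_map :: "nat \<Rightarrow> real \<times> real \<Rightarrow> real \<times> real" where
  "comb_map i z = (if i < 2 then 1 else ratio * fst z, (snd z + (if even i then 1 else -1)) / 2)"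

lemma ratio_pos: "0 < ratio"
  by (simp add: ratio_def)

lemma ratio_le: "ratio \<le> 1 / 2"
proof -
  have "2 \<le> 1 + 2 * pi" using pi_gt3 by simp
  also have "\<dots> \<le> exp (2 * pi)" by (rule exp_ge_add_one_self)
  finally show ?thesis
    by (simp add: ratio_def exp_minus field_simps)
qed

lemma exp_sub_period: "exp (- (\<theta> + 2 * pi * real k)) = ratio ^ k * exp (- \<theta>)"
proof -
  have "- (\<theta> + 2 * pi * real k) = real k * (- 2 * pi) + - \<theta>"
    by (simp add: algebra_simps)
  then show ?thesis
    by (simp only: exp_add exp_of_nat_mult ratio_def)
qed

lemma compact_comb: "compact comb"
proof -
  have "(\<lambda>k. ratio ^ k) \<longlonglongrightarrow> 0"
    using ratio_pos ratio_le by (intro LIMSEQ_realpow_zero) auto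
  then show ?thesis
    unfolding comb_def by (intro compact_Times compact_sequence_with_limit) auto
qed

lemma comb_subset: "comb \<subseteq> {0..1} \<times> {-1..1}"
  unfolding comb_def using ratio_pos ratio_le by (auto intro!: power_le_one)

lemma comb_map_self: "comb_map i z \<in> {0..1} \<times> {-1..1}" if "z \<in> {0..1} \<times> {-1..1}"
proof -
  have "ratio * fst z \<le> 1 * 1"
    using that ratio_pos ratio_le by (intro mult_mono) auto
  then show ?thesis
    using that ratio_pos by (auto simp: comb_map_def)
qed

lemma comb_map_lipschitz: "dist (comb_map i z) (comb_map i w) \<le> 1 / 2 * dist z w"
proof -
  have 1: "dist (fst (comb_map i z)) (fst (comb_map i w)) \<le> 1 / 2 * dist (fst z) (fst w)"
  proof -
    have "\<bar>ratio * fst z - ratio * fst w\<bar> = ratio * \<bar>fst z - fst w\<bar>"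
      using ratio_pos by (simp add: abs_mult flip: right_diff_distrib)
    also have "\<dots> \<le> 1 / 2 * \<bar>fst z - fst w\<bar>"
      using ratio_le by (intro mult_right_mono) auto
    finally show ?thesis by (auto simp: comb_map_def dist_real_def)
  qed
  have 2: "dist (snd (comb_map i z)) (snd (comb_map i w)) \<le> 1 / 2 * dist (snd z) (snd w)"
    by (auto simp: comb_map_def dist_real_def abs_if field_simps)
  have "dist (comb_map i z) (comb_map i w)
      \<le> sqrt ((1 / 2 * dist (fst z) (fst w))\<^sup>2 + (1 / 2 * dist (snd z) (snd w))\<^sup>2)"
    unfolding dist_prod_def using 1 2 by (intro real_sqrt_le_mono add_mono power_mono) auto
  also have "\<dots> = sqrt ((1 / 2)\<^sup>2 * ((dist (fst z) (fst w))\<^sup>2 + (dist (snd z) (snd w))\<^sup>2))"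
    by (simp only: power_mult_distrib distrib_left)
  also have "\<dots> = 1 / 2 * dist z w"
    unfolding dist_prod_def real_sqrt_mult by simp
  finally show ?thesis .
qed

lemma comb_eq: "comb = (\<Union>i\<in>{..<4}. comb_map i ` comb)"
proof
  show "comb \<subseteq> (\<Union>i\<in>{..<4}. comb_map i ` comb)"
  proof
    fix z assume "z \<in> comb"
    define x y where "x = fst z" and "y = snd z"
    have z: "z = (x, y)" and x: "x = 0 \<or> (\<exists>k. x = ratio ^ k)" and y: "-1 \<le> y" "y \<le> 1"
      using \<open>z \<in> comb\<close> by (auto simp: comb_def x_def y_def)
    obtain j :: nat and v where v: "j < 2" "-1 \<le> v" "v \<le> 1"
      "y = (v + (if even j then 1 else -1)) / 2"
    proof (cases "0 \<le> y")
      case True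
      with y show ?thesis by (intro that[of 0 "2 * y - 1"]) auto
    next
      case False
      with y show ?thesis by (intro that[of 1 "2 * y + 1"]) auto
    qed
    consider "x = 1" | u where "x = ratio * u" "u \<in> insert 0 (range (\<lambda>k. ratio ^ k))"
    proof -
      consider "x = 0" | "x = 1" | k where "x = ratio ^ Suc k"
        using x by (metis not0_implies_Suc power_0)
      then show ?thesis
        using that by cases auto
    qed
    then show "z \<in> (\<Union>i\<in>{..<4}. comb_map i ` comb)"
    proof cases
      case 1
      have "z = comb_map j (0, v)" using 1 v z by (simp add: comb_map_def)
      moreover have "(0, v) \<in> comb" using v by (simp add: comb_def)
      ultimately show ?thesis using v(1) by force
    next
      case 2
      have "z = comb_map (j + 2) (u, v)" using 2 v z by (simp add: comb_map_def)
      moreover have "(u, v) \<in> comb" using 2 v by (simp add: comb_def)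
      ultimately show ?thesis using v(1) by force
    qed
  qed
next
  define C where "C = insert 0 (range (\<lambda>k. ratio ^ k))"
  have comb: "comb = C \<times> {-1..1}"
    by (simp add: comb_def C_def)
  have scale: "ratio * u \<in> C" if "u \<in> C" for u
    using that by (auto simp: C_def simp flip: power_Suc)
  have one: "1 \<in> C"
    unfolding C_def by (intro insertI2 range_eqI[of _ _ 0]) simp
  have "comb_map i (x, y) \<in> comb" if "x \<in> C" "-1 \<le> y" "y \<le> 1" for i x y
    using that one scale[OF that(1)] by (simp add: comb comb_map_def)
  then have "comb_map i z \<in> comb" if "z \<in> comb" for i z
    using that unfolding comb by (cases z) simp
  then show "(\<Union>i\<in>{..<4}. comb_map i ` comb) \<subseteq> comb"
    by blast
qed

section \<open>The damped wave\<close>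

text \<open>The sine curve in the coordinate \<open>exp (- 1 / x)\<close> instead of \<open>x\<close>.\<close>

definition damped_wave :: "(real \<times> real) set" where
  "damped_wave = {0} \<times> {-1..1} \<union> {(exp (- s), sin s) | s. 1 \<le> s}"

text \<open>
  The angles for \<open>y \<in> [-1, 1]\<close> form the \<open>i\<close>-th of the consecutive intervals of length \<open>2 \<pi> / 32\<close>
  starting at \<open>1\<close>; the first 32 of them make up \<open>[1, 1 + 2 \<pi>]\<close>.  The number 32 is large enough for
  \<open>wave_map i\<close> below to be a contraction.
\<close>

definition angle :: "nat \<Rightarrow> real \<Rightarrow> real" where
  "angle i y = 1 + (pi / 32) * (2 * real i + 1 + y)"

text \<open>
  For \<open>i < 32\<close>, this map traces the \<open>i\<close>-th piece of the \<open>k\<close>-th period of the damped wave on the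
  tooth of the comb at \<open>ratio ^ k\<close>, and the corresponding part of the limiting segment on the
  tooth at \<open>0\<close>.
\<close>

definition wave_map :: "nat \<Rightarrow> real \<times> real \<Rightarrow> real \<times> real" where
  "wave_map i z = (fst z * exp (- angle i (snd z)), sin (angle i (snd z)))"

lemma angle_ge: "1 \<le> angle i y" if "-1 \<le> y"
  using that by (simp add: angle_def)

lemma angle_surj:
  assumes "1 \<le> \<theta>" "\<theta> < 1 + 2 * pi"
  obtains i y where "i < 32" "-1 \<le> y" "y \<le> 1" "\<theta> = angle i y"
proof -
  define t where "t = (\<theta> - 1) * 16 / pi"
  have t: "0 \<le> t" "t < 32" using assms by (auto simp: t_def field_simps)
  define i where "i = nat \<lfloor>t\<rfloor>"
  have i: "real i \<le> t" "t < real i + 1"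
    using t by (auto simp: i_def)
  show ?thesis
  proof (rule that[of i "2 * (t - real i) - 1"])
    show "i < 32" using i t by linarith
    show "\<theta> = angle i (2 * (t - real i) - 1)"
      by (simp add: angle_def t_def field_simps)
  qed (use i in auto)
qed

lemma damped_wave_eq: "damped_wave = (\<Union>i\<in>{..<32}. wave_map i ` comb)"
proof
  show "damped_wave \<subseteq> (\<Union>i\<in>{..<32}. wave_map i ` comb)"
  proof -
    have polar: "(x * exp (- \<theta>), sin \<theta>) \<in> (\<Union>i\<in>{..<32}. wave_map i ` comb)"
      if \<theta>: "1 \<le> \<theta>" "\<theta> < 1 + 2 * pi" and x: "x \<in> insert 0 (range (\<lambda>k. ratio ^ k))" for x \<theta>
    proof -
      obtain i y where iy: "i < 32" "-1 \<le> y" "y \<le> 1" "\<theta> = angle i y"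
        using angle_surj[OF \<theta>] by metis
      then have "(x, y) \<in> comb" using x by (simp add: comb_def)
      moreover have "(x * exp (- \<theta>), sin \<theta>) = wave_map i (x, y)"
        using iy by (simp add: wave_map_def)
      ultimately show ?thesis using iy(1) by force
    qed
    have period: "\<exists>k \<theta>. 1 \<le> \<theta> \<and> \<theta> < 1 + 2 * pi \<and> s = \<theta> + 2 * pi * real k" if "1 \<le> s" for s
    proof -
      define t where "t = (s - 1) / (2 * pi)"
      define k where "k = nat \<lfloor>t\<rfloor>"
      have "0 \<le> t" using that by (simp add: t_def)
      then have "real k \<le> t" "t < real k + 1" by (auto simp: k_def)
      then have "2 * pi * real k \<le> 2 * pi * t" "2 * pi * t < 2 * pi * (real k + 1)"
        by auto
      moreover have "2 * pi * t = s - 1" by (simp add: t_def)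
      ultimately show ?thesis
        by (intro exI[of _ k] exI[of _ "s - 2 * pi * real k"]) (auto simp: algebra_simps)
    qed
    have sin_period: "sin (\<theta> + 2 * pi * real k) = sin \<theta>" for \<theta> k
      using sin.plus_of_nat[of \<theta> k] by (simp add: mult_ac)
    have "(0, y) \<in> (\<Union>i\<in>{..<32}. wave_map i ` comb)" if "-1 \<le> y" "y \<le> 1" for y
    proof -
      \<comment> \<open>Shifting the arcsine by a full period makes it at least \<open>1\<close>.\<close>
      have "1 \<le> arcsin y + 2 * pi"
        using arcsin_lbound[OF that] pi_gt3 by linarith
      then obtain k \<theta> where \<theta>: "1 \<le> \<theta>" "\<theta> < 1 + 2 * pi" "arcsin y + 2 * pi = \<theta> + 2 * pi * real k"
        using period by blast
      have "sin \<theta> = sin (arcsin y + 2 * pi)" by (simp only: \<theta>(3) sin_period)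
      then have "sin \<theta> = y" using that by simp
      then show ?thesis using polar[of \<theta> 0] \<theta> by simp
    qed
    moreover have "(exp (- s), sin s) \<in> (\<Union>i\<in>{..<32}. wave_map i ` comb)" if "1 \<le> s" for s
    proof -
      obtain k \<theta> where \<theta>: "1 \<le> \<theta>" "\<theta> < 1 + 2 * pi" "s = \<theta> + 2 * pi * real k"
        using period \<open>1 \<le> s\<close> by blast
      have "(exp (- s), sin s) = (ratio ^ k * exp (- \<theta>), sin \<theta>)"
        by (simp only: \<theta>(3) exp_sub_period sin_period)
      then show ?thesis using polar[of \<theta> "ratio ^ k"] \<theta> by simp
    qed
    ultimately show ?thesis unfolding damped_wave_def by auto
  qed
next
  show "(\<Union>i\<in>{..<32}. wave_map i ` comb) \<subseteq> damped_wave"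
  proof -
    have "wave_map i (x, y) \<in> damped_wave"
      if x: "x \<in> insert 0 (range (\<lambda>k. ratio ^ k))" and y: "-1 \<le> y" for i x y
    proof (cases "x = 0")
      case True
      then show ?thesis by (simp add: wave_map_def damped_wave_def)
    next
      case False
      then obtain k where k: "x = ratio ^ k" using x by auto
      let ?s = "angle i y + 2 * pi * real k"
      have "1 \<le> ?s" using angle_ge[OF y, of i] by (simp add: add_increasing2)
      moreover have "sin ?s = sin (angle i y)"
        using sin.plus_of_nat[of "angle i y" k] by (simp add: mult_ac)
      then have "wave_map i (x, y) = (exp (- ?s), sin ?s)"
        by (simp only: wave_map_def fst_conv snd_conv exp_sub_period k)
      ultimately show ?thesis unfolding damped_wave_def by blast
    qed
    then show ?thesis unfolding comb_def by auto
  qed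
qed

lemma abs_sin_diff_le: "\<bar>sin a - sin b\<bar> \<le> \<bar>a - b\<bar>" for a b :: real
proof -
  have "\<bar>sin a - sin b\<bar> = 2 * \<bar>sin ((a - b) / 2)\<bar> * \<bar>cos ((a + b) / 2)\<bar>"
    by (simp add: sin_diff_sin abs_mult)
  also have "\<dots> \<le> 2 * \<bar>(a - b) / 2\<bar> * 1"
    by (intro mult_mono abs_sin_x_le_abs_x abs_cos_le_one) auto
  finally show ?thesis by simp
qed

lemma abs_exp_minus_diff_le: "\<bar>exp (- a) - exp (- b)\<bar> \<le> \<bar>a - b\<bar>"
  if "0 \<le> a" "0 \<le> b" for a b :: real
proof -
  have le: "\<bar>exp (- a) - exp (- b)\<bar> \<le> b - a" if "0 \<le> a" "a \<le> b" for a b :: real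
  proof -
    have "exp (- a) - exp (- b) = exp (- a) * (1 - exp (- (b - a)))"
      by (simp add: algebra_simps flip: exp_add)
    also have "\<dots> \<le> 1 * (b - a)"
      using that exp_ge_add_one_self[of "- (b - a)"] by (intro mult_mono) (simp_all add: algebra_simps)
    finally show ?thesis using that by simp
  qed
  show ?thesis
    using le[of a b] le[of b a] that by (cases "a \<le> b") auto
qed

lemma wave_map_self: "wave_map i z \<in> {0..1} \<times> {-1..1}" if "z \<in> {0..1} \<times> {-1..1}"
proof -
  have "fst z * exp (- angle i (snd z)) \<le> 1 * 1"
    using that angle_ge[of "snd z" i] by (intro mult_mono) auto
  then show ?thesis
    using that by (auto simp: wave_map_def)
qed

lemma wave_map_lipschitz:
  assumes "z \<in> {0..1} \<times> {-1..1}" "w \<in> {0..1} \<times> {-1..1}"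
  shows "dist (wave_map i z) (wave_map i w) \<le> 3 / 4 * dist z w"
proof -
  obtain x y x' y' where zw: "z = (x, y)" "w = (x', y')"
    and x: "0 \<le> x'" "x' \<le> 1" and y: "-1 \<le> y" "-1 \<le> y'"
    using assms by (cases z, cases w) auto
  define a b where "a = angle i y" and "b = angle i y'"
  have ab: "1 \<le> a" "1 \<le> b" using angle_ge y by (auto simp: a_def b_def)
  have diff: "\<bar>a - b\<bar> \<le> 1 / 8 * \<bar>y - y'\<bar>"
  proof -
    have "a - b = pi / 32 * (y - y')" by (simp add: a_def b_def angle_def field_simps)
    then have "\<bar>a - b\<bar> = pi / 32 * \<bar>y - y'\<bar>" by (simp only: abs_mult) simp
    also have "\<dots> \<le> 1 / 8 * \<bar>y - y'\<bar>" using pi_less_4 by (intro mult_right_mono) auto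
    finally show ?thesis .
  qed
  have exp_le: "exp (- a) \<le> 1 / 2"
  proof -
    have "2 \<le> exp a" using exp_ge_add_one_self[of a] ab by linarith
    then show ?thesis by (simp add: exp_minus field_simps)
  qed
  have "\<bar>x * exp (- a) - x' * exp (- b)\<bar> = \<bar>(x - x') * exp (- a) + x' * (exp (- a) - exp (- b))\<bar>"
    by (simp add: algebra_simps)
  also have "\<dots> \<le> \<bar>x - x'\<bar> * exp (- a) + x' * \<bar>exp (- a) - exp (- b)\<bar>"
    using x abs_triangle_ineq[of "(x - x') * exp (- a)" "x' * (exp (- a) - exp (- b))"]
    by (simp add: abs_mult)
  also have "\<dots> \<le> \<bar>x - x'\<bar> * (1 / 2) + 1 * \<bar>a - b\<bar>"
    using exp_le x ab by (intro add_mono mult_mono abs_exp_minus_diff_le) auto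
  finally have first: "\<bar>x * exp (- a) - x' * exp (- b)\<bar> \<le> 1 / 2 * \<bar>x - x'\<bar> + \<bar>a - b\<bar>"
    by simp
  have "dist (wave_map i z) (wave_map i w)
      \<le> \<bar>x * exp (- a) - x' * exp (- b)\<bar> + \<bar>sin a - sin b\<bar>"
    by (simp add: zw wave_map_def a_def b_def dist_Pair_Pair dist_real_def sqrt_sum_squares_le_sum_abs)
  also have "\<dots> \<le> 1 / 2 * \<bar>x - x'\<bar> + 1 / 4 * \<bar>y - y'\<bar>"
    using first diff abs_sin_diff_le[of a b] by linarith
  also have "\<dots> \<le> 3 / 4 * dist z w"
    using dist_fst_le[of z w] dist_snd_le[of z w] by (simp add: zw dist_real_def)
  finally show ?thesis .
qed

lemma compact_damped_wave: "compact damped_wave"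
proof -
  have "continuous_on comb (wave_map i)" for i
    unfolding wave_map_def angle_def by (intro continuous_intros)
  then show ?thesis
    unfolding damped_wave_eq by (intro compact_UN compact_continuous_image compact_comb) auto
qed

lemma damped_wave_homeomorphic: "damped_wave homeomorphic topologists_sine_curve"
proof (rule homeomorphic_compact[OF compact_damped_wave])
  \<comment> \<open>As \<open>ln 0 = 0\<close> and \<open>1 / 0 = 0\<close>, the formula has the right value \<open>0\<close> at \<open>t = 0\<close>.\<close>
  let ?h = "\<lambda>t::real. - 1 / ln t"
  let ?\<psi> = "\<lambda>z. (?h (fst z), snd z :: real)"
  have cont: "continuous_on {0..exp (-1)} ?h"
  proof -
    have "continuous (at t within {0..exp (-1)}) ?h" if t: "t \<in> {0..exp (-1)}" for t
    proof (cases "t = 0")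
      case True
      have "(?h \<longlongrightarrow> 0) (at_right 0)"
        by (intro tendsto_divide_0[OF tendsto_const] filterlim_at_bot_imp_at_infinity ln_at_0)
      then have "(?h \<longlongrightarrow> 0) (at 0 within {0..exp (-1)})"
        by (rule tendsto_mono[rotated]) (metis at_within_Icc_at_right at_le exp_gt_zero order_refl)
      then show ?thesis using True by (simp add: continuous_within)
    next
      case False
      have "exp (-1) < (1::real)" by simp
      with t False have "0 < t" "t < 1" by (auto simp del: exp_less_one_iff)
      then show ?thesis by (intro continuous_intros) auto
    qed
    then show ?thesis by (simp add: continuous_on_eq_continuous_within)
  qed
  have fst_mem: "fst ` damped_wave \<subseteq> {0..exp (-1)}"
    unfolding damped_wave_def by auto
  show "continuous_on damped_wave ?\<psi>"
    by (intro continuous_on_Pair continuous_on_compose2[OF cont _ fst_mem] continuous_intros)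
  show "inj_on ?\<psi> damped_wave"
    unfolding damped_wave_def by (rule inj_onI) auto
  show "?\<psi> ` damped_wave = topologists_sine_curve"
  proof -
    have "{(1 / s, sin s) | s::real. 1 \<le> s} = {(x, sin (1 / x)) | x. 0 < x \<and> x \<le> 1}"
    proof (intro equalityI subsetI)
      fix z assume "z \<in> {(1 / s, sin s) | s::real. 1 \<le> s}"
      then obtain s :: real where "z = (1 / s, sin s)" "1 \<le> s" by auto
      then show "z \<in> {(x, sin (1 / x)) | x. 0 < x \<and> x \<le> 1}"
        by (intro CollectI exI[of _ "1 / s"]) auto
    next
      fix z assume "z \<in> {(x, sin (1 / x)) | x::real. 0 < x \<and> x \<le> 1}"
      then obtain x :: real where "z = (x, sin (1 / x))" "0 < x" "x \<le> 1" by auto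
      then show "z \<in> {(1 / s, sin s) | s. 1 \<le> s}"
        by (intro CollectI exI[of _ "1 / x"]) auto
    qed
    moreover have "?\<psi> ` {(exp (- s), sin s) | s. 1 \<le> s} = {(1 / s, sin s) | s. 1 \<le> s}"
      by (force simp: image_def)
    moreover have "?\<psi> ` ({0} \<times> {-1..1}) = {0} \<times> {-1..1}"
      by (force simp: image_def)
    ultimately show ?thesis
      unfolding damped_wave_def topologists_sine_curve_def by (simp only: image_Un)
  qed
qed

section \<open>The sine curve as a limit set\<close>

theorem proposition4p10:
  shows "\<exists>(X :: (real \<times> real) set) (d :: real \<times> real \<Rightarrow> real \<times> real \<Rightarrow> real)
            (I :: nat \<Rightarrow> nat set) (f :: nat \<Rightarrow> nat \<Rightarrow> real \<times> real \<Rightarrow> real \<times> real).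
           nonautonomous_IFS X d I f \<and>
           subtopology (Metric_space.mtopology X d) (limit_set X I f)
             homeomorphic_space top_of_set topologists_sine_curve"
proof -
  define X :: "(real \<times> real) set" where "X = {0..1} \<times> {-1..1}"
  define I :: "nat \<Rightarrow> nat set" where "I j = (if j = 1 then {..<32} else {..<4})" for j
  define f where "f j = (if j = 1 then wave_map else comb_map)" for j :: nat
  define E where "E j = (if j = 1 then damped_wave else comb)" for j :: nat
  have X: "compact X" "X \<noteq> {}"
    by (auto simp: X_def intro: compact_Times)
  have self: "f j i z \<in> X" if "z \<in> X" for j i z
    using that wave_map_self comb_map_self by (simp add: f_def X_def)
  have lip: "dist (f j i z) (f j i w) \<le> 3 / 4 * dist z w" if "z \<in> X" "w \<in> X" for j i z w
  proof (cases "j = 1")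
    case True
    then show ?thesis using that wave_map_lipschitz by (simp add: f_def X_def)
  next
    case False
    then show ?thesis
      using order_trans[OF comb_map_lipschitz mult_right_mono[of "1 / 2" "3 / 4" "dist z w"]]
      by (simp add: f_def)
  qed
  have IFS: "nonautonomous_IFS X dist I f"
    by (rule nonautonomous_IFS_dist[where c = "3 / 4"])
      (use X self lip in \<open>auto simp: I_def lessThan_empty_iff\<close>)
  have E_eq: "E j = (\<Union>i\<in>I j. f j i ` E (Suc j))" if "1 \<le> j" for j
    using that damped_wave_eq comb_eq by (auto simp: E_def I_def f_def)
  have comb_ne: "comb \<noteq> {}"
    by (auto simp: comb_def)
  have wave: "damped_wave \<noteq> {}" "damped_wave \<subseteq> X"
    by (auto simp: damped_wave_def X_def)
  have "limit_set X I f = E 1"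
  proof (rule limit_set_eqI[where c = "3 / 4" and E = E])
    show "compact (E j)" "E j \<noteq> {}" "E j \<subseteq> X" for j
      using compact_comb compact_damped_wave comb_ne wave comb_subset
      by (auto simp: E_def X_def)
    show "E j = (\<Union>i\<in>I j. f j i ` E (Suc j))" if "1 \<le> j" for j
      using that by (rule E_eq)
  qed (use X self lip in auto)
  then have "limit_set X I f = damped_wave" by (simp add: E_def)
  moreover have "subtopology (top_of_set X) damped_wave = top_of_set damped_wave"
    using wave by (simp add: subtopology_subtopology Int_absorb1)
  moreover have "top_of_set damped_wave homeomorphic_space top_of_set topologists_sine_curve"
  proof -
    obtain g h where "homeomorphism damped_wave topologists_sine_curve g h"
      using damped_wave_homeomorphic by (auto simp: homeomorphic_def)
    then have "homeomorphic_maps (top_of_set damped_wave) (top_of_set topologists_sine_curve) g h"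
      by (auto simp: homeomorphism_def homeomorphic_maps_def)
    then show ?thesis
      by (rule homeomorphic_maps_imp_homeomorphic_space)
  qed
  ultimately have "subtopology (Metric_space.mtopology X dist) (limit_set X I f)
      homeomorphic_space top_of_set topologists_sine_curve"
    by (simp add: mtopology_dist_eq)
  with IFS show ?thesis by blast
qed

end
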